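(* Let $(\mathfrak{g},[~,~]_\mathfrak{g},\alpha)$ and $(\mathfrak{h},[~,~]_\mathfrak{h},\beta)$ be two (multiplicative) Hom-Lie algebras and let $\varphi:\mathfrak{g}\to\mathfrak{h}$ be a morphism of Hom-Lie algebras. For a linear map $\varphi':\mathfrak{g}\to\mathfrak{h}$ satisfying $\beta\circ\varphi'=\varphi'\circ\alpha$, the sum $\varphi+\varphi'$ is a Hom-Lie algebra morphism if and only if $\varphi'\in C^1_{\mathrm{Hom}}(\mathfrak{g},\mathfrak{h})$ is a Maurer-Cartan element in the differential graded Lie algebra $(C^\bullet_{\mathrm{Hom}}(\mathfrak{g},\mathfrak{h}),[~,~]_{\mathsf{C}},D_\varphi)$.
   Context: All vector spaces and (multi)linear maps are over a field $\mathbf{k}$ of characteristic $0$. A (multiplicative) Hom-Lie algebra $(\mathfrak{g},[~,~],\alpha)$ is a vector space $\mathfrak{g}$ with a skew-symmetric bilinear map $[~,~]$ and a linear map $\alpha:\mathfrak{g}\to\mathfrak{g}$ such that $[\alpha(x),[y,z]]+[\alpha(y),[z,x]]+[\alpha(z),[x,y]]=0$ and $\alpha([x,y])=[\alpha(x),\alpha(y)]$. A morphism from $(\mathfrak{g},[~,~]_\mathfrak{g},\alpha)$ to $(\mathfrak{h},[~,~]_\mathfrak{h},\beta)$ is a linear map $\varphi$ with $\beta\circ\varphi=\varphi\circ\alpha$ and $\varphi([x,y]_\mathfrak{g})=[\varphi(x),\varphi(y)]_\mathfrak{h}$. For $n\ge 1$, $C^n_{\mathrm{Hom}}(\mathfrak{g},\mathfrak{h})=\{f:\wedge^n\mathfrak{g}\to\mathfrak{h}\mid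 \beta\circ f=f\circ\alpha^{\wedge n}\}$, in degree $n$, and $C^\bullet_{\mathrm{Hom}}(\mathfrak{g},\mathfrak{h})=\bigoplus_{n\ge1}C^n_{\mathrm{Hom}}(\mathfrak{g},\mathfrak{h})$. With $Sh(m,n)$ the set of $(m,n)$-shuffles, the cup product bracket is, for $P\in C^m_{\mathrm{Hom}}(\mathfrak{g},\mathfrak{h})$, $Q\in C^n_{\mathrm{Hom}}(\mathfrak{g},\mathfrak{h})$, $$[P,Q]_{\mathsf{C}}(x_1,\ldots,x_{m+n})=\sum_{\sigma\in Sh(m,n)}(-1)^\sigma[\beta^{n-1}P(x_{\sigma(1)},\ldots,x_{\sigma(m)}),\beta^{m-1}Q(x_{\sigma(m+1)},\ldots,x_{\sigma(m+n)})]_\mathfrak{h}.$$ The map $D:C^n_{\mathrm{Hom}}(\mathfrak{g},\mathfrak{h})\to C^{n+1}_{\mathrm{Hom}}(\mathfrak{g},\mathfrak{h})$ is $$(Df)(x_1,\ldots,x_{n+1})=\sum_{1\le i<j\le n+1}(-1)^{i+j}f([x_i,x_j]_\mathfrak{g},\alpha(x_1),\ldots,\widehat{\alpha(x_i)},\ldots,\widehat{\alpha(x_j)},\ldots,\alpha(x_{n+1})),$$ and $D_\varphi(f)=Df+[\varphi,f]_{\mathsf{C}}$. The triple $(C^\bullet_{\mathrm{Hom}}(\mathfrak{g},\mathfrak{h}),[~,~]_{\mathsf{C}},D_\varphi)$ is a differential graded Lie algebra. A Maurer-Cartan element of a differential graded Lie algebra $(\mathcal{L},[~,~],d)$ is $s\in\mathcal{L}^1$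 with $ds+\frac12[s,s]=0$. *)

theory Defs
  imports Complex_Main "HOL-Library.Function_Algebras" "HOL-Combinatorics.Permutations"
begin

section \<open>Hom-Lie algebras\<close>

locale hom_lie_algebra = vector_space scale
  for scale :: "'k::field_char_0 \<Rightarrow> 'g::ab_group_add \<Rightarrow> 'g" +
  fixes bracket :: "'g \<Rightarrow> 'g \<Rightarrow> 'g" and \<alpha> :: "'g \<Rightarrow> 'g"
  assumes linear_bracket_right: "Vector_Spaces.linear scale scale (\<lambda>y. bracket x y)"
    and linear_bracket_left: "Vector_Spaces.linear scale scale (\<lambda>x. bracket x y)"
    and skew: "bracket x y = - bracket y x"
    and linear_twist: "Vector_Spaces.linear scale scale \<alpha>"
    and hom_jacobi:
      "bracket (\<alpha> x) (bracket y z) + bracket (\<alpha> y) (bracket z x)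
        + bracket (\<alpha> z) (bracket x y) = 0"
    and multiplicative: "\<alpha> (bracket x y) = bracket (\<alpha> x) (\<alpha> y)"

definition hom_lie_morphism ::
  "('k::field_char_0 \<Rightarrow> 'g::ab_group_add \<Rightarrow> 'g) \<Rightarrow> ('g \<Rightarrow> 'g \<Rightarrow> 'g) \<Rightarrow> ('g \<Rightarrow> 'g) \<Rightarrow>
   ('k \<Rightarrow> 'h::ab_group_add \<Rightarrow> 'h) \<Rightarrow> ('h \<Rightarrow> 'h \<Rightarrow> 'h) \<Rightarrow> ('h \<Rightarrow> 'h) \<Rightarrow>
   ('g \<Rightarrow> 'h) \<Rightarrow> bool" where
  "hom_lie_morphism scale_g bracket_g \<alpha> scale_h bracket_h \<beta> \<phi> \<longleftrightarrow>
     Vector_Spaces.linear scale_g scale_h \<phi> \<and>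
     \<beta> \<circ> \<phi> = \<phi> \<circ> \<alpha> \<and>
     (\<forall>x y. \<phi> (bracket_g x y) = bracket_h (\<phi> x) (\<phi> y))"


section \<open>Maurer-Cartan elements\<close>

text \<open>
  The data of a differential graded Lie algebra, given degree by degree: the homogeneous
  component of each degree (a subset of a common ambient type), the scalar multiplication,
  the bracket of elements of degrees \<open>m\<close> and \<open>n\<close>, and the differential on degree \<open>n\<close>.
  The Maurer-Cartan equation refers to these data only, so the record carries no axioms.
\<close>

record ('k, 'v) dg_lie =
  component :: "nat \<Rightarrow> 'v set"
  dg_scale :: "'k \<Rightarrow> 'v \<Rightarrow> 'v"
  dg_bracket :: "nat \<Rightarrow> nat \<Rightarrow> 'v \<Rightarrow> 'v \<Rightarrow> 'v"
  dg_diff :: "nat \<Rightarrow> 'v \<Rightarrow> 'v"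

definition maurer_cartan ::
  "('k::field_char_0, 'v::ab_group_add) dg_lie \<Rightarrow> 'v \<Rightarrow> bool" where
  "maurer_cartan L s \<longleftrightarrow>
     s \<in> component L 1 \<and>
     dg_diff L 1 s + dg_scale L (1/2) (dg_bracket L 1 1 s s) = 0"


section \<open>The cochain complex\<close>

text \<open>
  A linear map on the \<open>n\<close>-th exterior power is represented by the corresponding alternating
  multilinear map, as a function on argument lists \<open>[x\<^sub>1, \<dots>, x\<^sub>n]\<close>. It takes the value 0
  on lists of any other length, so that equality of cochains is equality of functions.
  Positions are numbered from 0. There is nothing in degree 0.
\<close>

definition alternating_multilinear ::
  "('k::field_char_0 \<Rightarrow> 'g::ab_group_add \<Rightarrow> 'g) \<Rightarrow> ('k \<Rightarrow> 'h::ab_group_add \<Rightarrow> 'h) \<Rightarrow>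
   nat \<Rightarrow> ('g list \<Rightarrow> 'h) \<Rightarrow> bool" where
  "alternating_multilinear scale_g scale_h n f \<longleftrightarrow>
     (\<forall>xs. length xs \<noteq> n \<longrightarrow> f xs = 0) \<and>
     (\<forall>xs i. length xs = n \<longrightarrow> i < n \<longrightarrow>
        Vector_Spaces.linear scale_g scale_h (\<lambda>x. f (xs[i := x]))) \<and>
     (\<forall>xs i j. length xs = n \<longrightarrow> i < j \<longrightarrow> j < n \<longrightarrow> xs ! i = xs ! j \<longrightarrow> f xs = 0)"

definition hom_cochains ::
  "('k::field_char_0 \<Rightarrow> 'g::ab_group_add \<Rightarrow> 'g) \<Rightarrow> ('g \<Rightarrow> 'g) \<Rightarrow>
   ('k \<Rightarrow> 'h::ab_group_add \<Rightarrow> 'h) \<Rightarrow> ('h \<Rightarrow> 'h) \<Rightarrow> nat \<Rightarrow> ('g list \<Rightarrow> 'h) set" where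
  "hom_cochains scale_g \<alpha> scale_h \<beta> n =
     (if n = 0 then {0}
      else {f. alternating_multilinear scale_g scale_h n f \<and>
               (\<forall>xs. length xs = n \<longrightarrow> \<beta> (f xs) = f (map \<alpha> xs))})"

definition cochain_of_map :: "('g \<Rightarrow> 'h) \<Rightarrow> 'g list \<Rightarrow> 'h::ab_group_add" where
  "cochain_of_map f xs = (case xs of [x] \<Rightarrow> f x | _ \<Rightarrow> 0)"

definition shuffle_perms :: "nat \<Rightarrow> nat \<Rightarrow> (nat \<Rightarrow> nat) set" where
  "shuffle_perms m n =
     {\<sigma>. \<sigma> permutes {..<m + n} \<and>
         strict_mono_on {..<m} \<sigma> \<and> strict_mono_on {m..<m + n} \<sigma>}"

text \<open>The truncated subtractions below are only ever relevant for \<open>m, n \<ge> 1\<close>.\<close>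

definition cup_bracket ::
  "('k::field_char_0 \<Rightarrow> 'h::ab_group_add \<Rightarrow> 'h) \<Rightarrow> ('h \<Rightarrow> 'h \<Rightarrow> 'h) \<Rightarrow> ('h \<Rightarrow> 'h) \<Rightarrow>
   nat \<Rightarrow> nat \<Rightarrow> ('g list \<Rightarrow> 'h) \<Rightarrow> ('g list \<Rightarrow> 'h) \<Rightarrow> 'g list \<Rightarrow> 'h" where
  "cup_bracket scale_h bracket_h \<beta> m n P Q xs =
     (if length xs = m + n then
        \<Sum>\<sigma>\<in>shuffle_perms m n. scale_h (of_int (sign \<sigma>))
          (bracket_h
             ((\<beta> ^^ (n - 1)) (P (map (\<lambda>i. xs ! \<sigma> i) [0..<m])))
             ((\<beta> ^^ (m - 1)) (Q (map (\<lambda>i. xs ! \<sigma> i) [m..<m + n]))))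
      else 0)"

text \<open>
  \<open>nths xs (- {i, j})\<close> is \<open>xs\<close> with the entries at positions \<open>i\<close> and \<open>j\<close> left out; numbering
  from 0 instead of 1 does not change the parity of \<open>i + j\<close>.
\<close>

definition cochain_D ::
  "('k::field_char_0 \<Rightarrow> 'h::ab_group_add \<Rightarrow> 'h) \<Rightarrow> ('g \<Rightarrow> 'g \<Rightarrow> 'g) \<Rightarrow> ('g \<Rightarrow> 'g) \<Rightarrow>
   nat \<Rightarrow> ('g list \<Rightarrow> 'h) \<Rightarrow> 'g list \<Rightarrow> 'h" where
  "cochain_D scale_h bracket_g \<alpha> n f xs =
     (if length xs = n + 1 then
        \<Sum>(i, j) \<in> {(i, j). i < j \<and> j < n + 1}. scale_h ((-1) ^ (i + j))
          (f (bracket_g (xs ! i) (xs ! j) # map \<alpha> (nths xs (- {i, j}))))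
      else 0)"

definition cochain_D_twisted ::
  "('k::field_char_0 \<Rightarrow> 'h::ab_group_add \<Rightarrow> 'h) \<Rightarrow> ('g \<Rightarrow> 'g \<Rightarrow> 'g) \<Rightarrow> ('g \<Rightarrow> 'g) \<Rightarrow>
   ('h \<Rightarrow> 'h \<Rightarrow> 'h) \<Rightarrow> ('h \<Rightarrow> 'h) \<Rightarrow> ('g \<Rightarrow> 'h) \<Rightarrow>
   nat \<Rightarrow> ('g list \<Rightarrow> 'h) \<Rightarrow> 'g list \<Rightarrow> 'h" where
  "cochain_D_twisted scale_h bracket_g \<alpha> bracket_h \<beta> \<phi> n f =
     cochain_D scale_h bracket_g \<alpha> n f
     + cup_bracket scale_h bracket_h \<beta> 1 n (cochain_of_map \<phi>) f"

definition hom_cochain_dgla ::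
  "('k::field_char_0 \<Rightarrow> 'g::ab_group_add \<Rightarrow> 'g) \<Rightarrow> ('g \<Rightarrow> 'g \<Rightarrow> 'g) \<Rightarrow> ('g \<Rightarrow> 'g) \<Rightarrow>
   ('k \<Rightarrow> 'h::ab_group_add \<Rightarrow> 'h) \<Rightarrow> ('h \<Rightarrow> 'h \<Rightarrow> 'h) \<Rightarrow> ('h \<Rightarrow> 'h) \<Rightarrow>
   ('g \<Rightarrow> 'h) \<Rightarrow> ('k, 'g list \<Rightarrow> 'h) dg_lie" where
  "hom_cochain_dgla scale_g bracket_g \<alpha> scale_h bracket_h \<beta> \<phi> =
     \<lparr> component = hom_cochains scale_g \<alpha> scale_h \<beta>,
       dg_scale = (\<lambda>c f xs. scale_h c (f xs)),
       dg_bracket = cup_bracket scale_h bracket_h \<beta>,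
       dg_diff = cochain_D_twisted scale_h bracket_g \<alpha> bracket_h \<beta> \<phi> \<rparr>"

end

theory Submission
  imports Defs
begin

text \<open>
  Everything happens in degrees 1 and 2, where the structure maps are short enough to be
  written out. The only \<open>(1,1)\<close>-shuffles are the identity and the transposition, so for
  linear maps \<open>f\<close> and \<open>g\<close>, regarded as 1-cochains, the bracket takes \<open>(x, y)\<close> to
  \<open>[f x, g y] - [f y, g x]\<close>, which is \<open>[f x, g y] + [g x, f y]\<close> by skew-symmetry; in
  particular \<open>[f, f]\<close> takes \<open>(x, y)\<close> to \<open>2 [f x, f y]\<close>. The differential takes \<open>f\<close> to the
  cochain \<open>- f [x, y] + [\<phi> x, f y] + [f x, \<phi> y]\<close>. The Maurer-Cartan equation for \<open>\<phi>'\<close>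
  therefore reads
  \<open>\<phi>' [x, y] = [\<phi> x, \<phi>' y] + [\<phi>' x, \<phi> y] + [\<phi>' x, \<phi>' y]\<close>.
  Adding \<open>\<phi> [x, y] = [\<phi> x, \<phi> y]\<close> on both sides turns this into
  \<open>(\<phi> + \<phi>') [x, y] = [(\<phi> + \<phi>') x, (\<phi> + \<phi>') y]\<close>, by biadditivity of the bracket. The
  remaining clauses of a morphism, linearity and compatibility with the twists, pass from
  \<open>\<phi>\<close> and \<open>\<phi>'\<close> to the sum; for \<open>\<phi>'\<close> alone they say that it is a 1-cochain.
\<close>

lemma cochain_of_map_in_hom_cochains:
  assumes "Vector_Spaces.linear scale_g scale_h f"
    and "\<beta> \<circ> f = f \<circ> \<alpha>"
  shows "cochain_of_map f \<in> hom_cochains scale_g \<alpha> scale_h \<beta> 1"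
proof -
  have on_singletons: "cochain_of_map f [x] = f x" for x
    by (simp add: cochain_of_map_def)
  have equivariant: "\<beta> (f x) = f (\<alpha> x)" for x
    using assms(2) by (simp add: fun_eq_iff)
  have other_lengths: "cochain_of_map f xs = 0" if "length xs \<noteq> 1" for xs
    using that by (auto simp: cochain_of_map_def split: list.splits)
  show ?thesis
    using assms(1) other_lengths
    by (auto simp: hom_cochains_def alternating_multilinear_def length_Suc_conv
        on_singletons equivariant)
qed

lemma shuffle_perms_1_1: "shuffle_perms 1 1 = {id, Transposition.transpose 0 1}"
proof -
  have "{..<1 + 1} = {0, 1 :: nat}"
    by auto
  then show ?thesis
    by (auto simp: shuffle_perms_def permutes_doubleton_iff strict_mono_on_def)
qed

lemma (in hom_lie_algebra) cup_bracket_1_1: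
  "cup_bracket scale bracket \<alpha> 1 1 (cochain_of_map f) (cochain_of_map g) [x, y]
     = bracket (f x) (g y) + bracket (g x) (f y)"
proof -
  have distinct: "id \<noteq> Transposition.transpose 0 (1 :: nat)"
    by (metis id_apply transpose_apply_first zero_neq_one)
  have "cup_bracket scale bracket \<alpha> 1 1 (cochain_of_map f) (cochain_of_map g) [x, y]
      = bracket (f x) (g y) - bracket (f y) (g x)"
    using distinct shuffle_perms_1_1
    by (simp add: cup_bracket_def cochain_of_map_def sign_id sign_swap_id)
  then show ?thesis
    using skew[of "f y" "g x"] by simp
qed

lemma (in hom_lie_algebra) cochain_D_1:
  "cochain_D scale br twist 1 (cochain_of_map f) [x, y] = - f (br x y)"
proof -
  have pairs: "{(i, j). i < j \<and> j < 1 + 1} = {(0, 1 :: nat)}"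
    by auto
  have "nths [x, y] (- {0, 1}) = []"
    by (simp add: nths_Cons)
  then show ?thesis
    unfolding cochain_D_def pairs by (simp add: cochain_of_map_def)
qed

text \<open>
  Since cochains vanish on lists of the wrong length, an identity between 2-cochains only
  has to be tested on pairs. Characteristic 0 enters here, in cancelling the \<open>1/2\<close> against
  the two equal terms of \<open>[f, f]\<close>.
\<close>

lemma maurer_cartan_equation_iff:
  assumes "hom_lie_algebra scale_h bracket_h \<beta>"
  shows "cochain_D_twisted scale_h bracket_g \<alpha> bracket_h \<beta> \<phi> 1 (cochain_of_map f)
      + (\<lambda>xs. scale_h (1/2)
          (cup_bracket scale_h bracket_h \<beta> 1 1 (cochain_of_map f) (cochain_of_map f) xs)) = 0
    \<longleftrightarrow> (\<forall>x y. f (bracket_g x y)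
          = bracket_h (\<phi> x) (f y) + bracket_h (f x) (\<phi> y) + bracket_h (f x) (f y))"
    (is "?mc = 0 \<longleftrightarrow> (\<forall>x y. f (bracket_g x y) = ?rhs x y)")
proof -
  interpret h: hom_lie_algebra scale_h bracket_h \<beta>
    by (fact assms)
  have half: "scale_h (1/2) (v + v) = v" for v
  proof -
    have "scale_h (1/2) (v + v) = scale_h (1/2 + 1/2) v"
      by (simp only: h.scale_left_distrib h.scale_right_distrib)
    then show ?thesis
      by simp
  qed
  have on_pairs: "?mc [x, y] = ?rhs x y - f (bracket_g x y)" for x y
    by (simp add: cochain_D_twisted_def h.cup_bracket_1_1[simplified]
        h.cochain_D_1[simplified] half)
  have elsewhere: "?mc xs = 0" if "length xs \<noteq> 2" for xs
    using that by (simp add: cochain_D_twisted_def cochain_D_def cup_bracket_def)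
  have "?mc = 0 \<longleftrightarrow> (\<forall>x y. ?mc [x, y] = 0)"
  proof
    assume zero: "\<forall>x y. ?mc [x, y] = 0"
    show "?mc = 0"
    proof
      fix xs
      show "?mc xs = 0 xs"
      proof (cases "length xs = 2")
        case True
        then obtain x y where "xs = [x, y]"
          by (auto simp: numeral_2_eq_2 length_Suc_conv)
        then show ?thesis
          using zero by simp
      qed (use elsewhere in simp)
    qed
  qed simp
  also have "\<dots> \<longleftrightarrow> (\<forall>x y. f (bracket_g x y) = ?rhs x y)"
    unfolding on_pairs right_minus_eq by metis
  finally show ?thesis .
qed

theorem proposition3p4:
  fixes scale_g :: "'k::field_char_0 \<Rightarrow> 'g::ab_group_add \<Rightarrow> 'g"
    and bracket_g :: "'g \<Rightarrow> 'g \<Rightarrow> 'g" and \<alpha> :: "'g \<Rightarrow> 'g"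
    and scale_h :: "'k \<Rightarrow> 'h::ab_group_add \<Rightarrow> 'h"
    and bracket_h :: "'h \<Rightarrow> 'h \<Rightarrow> 'h" and \<beta> :: "'h \<Rightarrow> 'h"
    and \<phi> \<phi>' :: "'g \<Rightarrow> 'h"
  assumes "hom_lie_algebra scale_g bracket_g \<alpha>"
    and "hom_lie_algebra scale_h bracket_h \<beta>"
    and "hom_lie_morphism scale_g bracket_g \<alpha> scale_h bracket_h \<beta> \<phi>"
    and "Vector_Spaces.linear scale_g scale_h \<phi>'"
    and "\<beta> \<circ> \<phi>' = \<phi>' \<circ> \<alpha>"
  shows "hom_lie_morphism scale_g bracket_g \<alpha> scale_h bracket_h \<beta> (\<phi> + \<phi>') \<longleftrightarrow>
         maurer_cartan (hom_cochain_dgla scale_g bracket_g \<alpha> scale_h bracket_h \<beta> \<phi>)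
           (cochain_of_map \<phi>')"
proof -
  interpret h: hom_lie_algebra scale_h bracket_h \<beta>
    by (fact assms(2))
  have phi_linear: "Vector_Spaces.linear scale_g scale_h \<phi>"
    and phi_twist: "\<beta> \<circ> \<phi> = \<phi> \<circ> \<alpha>"
    and phi_bracket: "\<phi> (bracket_g x y) = bracket_h (\<phi> x) (\<phi> y)" for x y
    using assms(3) by (auto simp: hom_lie_morphism_def)
  have sum_linear: "Vector_Spaces.linear scale_g scale_h (\<phi> + \<phi>')"
    using phi_linear assms(4)
    by (simp add: Vector_Spaces.linear_iff plus_fun_def h.scale_right_distrib add_ac)
  have sum_twist: "\<beta> \<circ> (\<phi> + \<phi>') = (\<phi> + \<phi>') \<circ> \<alpha>"
    using phi_twist assms(5) h.linear_twist
    by (simp add: fun_eq_iff Vector_Spaces.linear_iff)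
  have bracket_add: "bracket_h (a + b) (c + d)
      = bracket_h a c + (bracket_h a d + bracket_h b c + bracket_h b d)" for a b c d
    using h.linear_bracket_left h.linear_bracket_right by (simp add: Vector_Spaces.linear_iff)
  have "hom_lie_morphism scale_g bracket_g \<alpha> scale_h bracket_h \<beta> (\<phi> + \<phi>')
      \<longleftrightarrow> (\<forall>x y. \<phi>' (bracket_g x y) = bracket_h (\<phi> x) (\<phi>' y) + bracket_h (\<phi>' x) (\<phi> y)
             + bracket_h (\<phi>' x) (\<phi>' y))"
    using sum_linear sum_twist by (simp add: hom_lie_morphism_def phi_bracket bracket_add)
  also have "\<dots> \<longleftrightarrow> maurer_cartan
      (hom_cochain_dgla scale_g bracket_g \<alpha> scale_h bracket_h \<beta> \<phi>) (cochain_of_map \<phi>')"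
    using cochain_of_map_in_hom_cochains[OF assms(4,5)]
    by (simp only: maurer_cartan_def hom_cochain_dgla_def dg_lie.simps
        maurer_cartan_equation_iff[OF assms(2)] simp_thms)
  finally show ?thesis .
qed

end
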